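(* Let $\Sigma$ be a (real) symmetric positive definite matrix with Cholesky decomposition $\Sigma = C C^{\top}$. If the off-diagonal entries of $\Sigma^{-1}$ are all nonpositive, then the elements of $C$ are all nonnegative.
   Context: $\Sigma$ is a $d \times d$ matrix with arbitrary $d \in \mathbb{N} = \{1, 2, \ldots\}$. The Cholesky decomposition of a real symmetric positive definite matrix $\Sigma$ is the unique factorization $\Sigma = C C^{\top}$ in which $C$ is a real lower triangular matrix with strictly positive diagonal entries. *)

theory Defs
  imports "HOL-Analysis.Analysis"
begin

(* The index type of a d x d matrix plays the role of {1, ..., d}, d = CARD('n).  Triangularity
   refers to the order of the indices, hence the sort {finite,wellorder} below, as in
   det_lowerdiagonal; the numeral types provide an instance for every d >= 1. *)

definition symmetric_matrix :: "real^'n^'n \<Rightarrow> bool" where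
  "symmetric_matrix A \<longleftrightarrow> transpose A = A"

definition positive_definite :: "real^'n^'n \<Rightarrow> bool" where
  "positive_definite A \<longleftrightarrow> (\<forall>x. x \<noteq> 0 \<longrightarrow> x \<bullet> (A *v x) > 0)"

definition lower_triangular :: "real^'n::{finite,wellorder}^'n::{finite,wellorder} \<Rightarrow> bool" where
  "lower_triangular A \<longleftrightarrow> (\<forall>i j. i < j \<longrightarrow> A $ i $ j = 0)"

definition is_cholesky_decomposition ::
    "real^'n::{finite,wellorder}^'n::{finite,wellorder} \<Rightarrow>
     real^'n::{finite,wellorder}^'n::{finite,wellorder} \<Rightarrow> bool" where
  "is_cholesky_decomposition A C \<longleftrightarrow>
     lower_triangular C \<and> (\<forall>i. C $ i $ i > 0) \<and> A = C ** transpose C"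

end

theory Submission
  imports Defs
begin

text \<open>
  Put M = \<open>matrix_inv \<Sigma>\<close>. Since M C is the inverse of the transpose of C, it is upper triangular,
  so M maps the column x of C with index j to a vector that vanishes at every index above j,
  whereas x vanishes below j and is positive at j. So M x vanishes on the support of the negative
  part n of x. Writing p for the positive part, 0 = n \<bullet> M x = n \<bullet> M p - n \<bullet> M n, where n \<bullet> M p \<le> 0
  because n and p have disjoint supports and the off-diagonal entries of M are nonpositive.
  Hence n \<bullet> M n \<le> 0, and n = 0 by positive definiteness.
\<close>

text \<open>\<open>matrix_inv\<close> is a Hilbert choice, so its two equations are available once
  some two-sided inverse exists.\<close>

lemma matrix_inv_inverse:
  fixes A :: "'a::semiring_1^'n^'m"
  assumes "invertible A"
  shows matrix_inv_right: "A ** matrix_inv A = mat 1"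
    and matrix_inv_left: "matrix_inv A ** A = mat 1"
  using someI_ex[OF assms[unfolded invertible_def]] by (simp_all add: matrix_inv_def)

lemma positive_definite_imp_invertible:
  fixes A :: "real^'n^'n"
  assumes "positive_definite A"
  shows "invertible A"
proof -
  have "x = 0" if "A *v x = 0" for x
    using assms that unfolding positive_definite_def by (metis inner_zero_right less_irrefl)
  then show ?thesis
    using invertible_left_inverse matrix_left_invertible_ker by blast
qed

text \<open>Substituting \<open>x = A *v y\<close> turns the quadratic form of the inverse at
  \<open>x\<close> into that of \<open>A\<close> at \<open>y\<close>.\<close>

lemma positive_definite_matrix_inv:
  fixes A :: "real^'n^'n"
  assumes "positive_definite A"
  shows "positive_definite (matrix_inv A)"
  unfolding positive_definite_def
proof (intro allI impI)
  fix x :: "real^'n" assume "x \<noteq> 0"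
  define y where "y = matrix_inv A *v x"
  have x: "x = A *v y"
    by (simp add: y_def matrix_vector_mul_assoc matrix_inv_right
        positive_definite_imp_invertible[OF assms])
  with \<open>x \<noteq> 0\<close> have "y \<noteq> 0" by auto
  then have "y \<bullet> x > 0"
    using assms x by (simp add: positive_definite_def)
  then show "x \<bullet> (matrix_inv A *v x) > 0"
    by (simp add: y_def inner_commute)
qed

text \<open>Back substitution along row \<open>i\<close> of \<open>U\<close>, by strong induction on
  the column: in the vanishing entry \<open>(i, j)\<close> of the product only
  \<open>U $ i $ j * C $ j $ j\<close> survives.\<close>

lemma lower_triangular_transpose_left_inverse:
  fixes C U :: "real^'n::{finite,wellorder}^'n::{finite,wellorder}"
  assumes C: "lower_triangular C" and diag: "\<And>i. C $ i $ i \<noteq> 0"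
    and U: "U ** transpose C = mat 1"
  shows "j < i \<Longrightarrow> U $ i $ j = 0"
proof (induction j rule: less_induct)
  case (less j)
  have "0 = (U ** transpose C) $ i $ j"
    using less.prems by (simp add: U mat_def)
  also have "\<dots> = (\<Sum>k\<in>UNIV. U $ i $ k * C $ j $ k)"
    by (simp add: matrix_matrix_mult_def transpose_def)
  also have "\<dots> = (\<Sum>k\<in>{j}. U $ i $ k * C $ j $ k)"
  proof (rule sum.mono_neutral_right)
    show "\<forall>k\<in>UNIV - {j}. U $ i $ k * C $ j $ k = 0"
    proof
      fix k assume "k \<in> UNIV - {j}"
      \<comment> \<open>For \<open>k < j\<close> the induction hypothesis applies since
        \<open>k < j < i\<close>; for \<open>j < k\<close> the factor \<open>C $ j $ k\<close> is
        zero.\<close>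
      then consider "k < j" | "j < k" by fastforce
      then show "U $ i $ k * C $ j $ k = 0"
        using less C by cases (auto simp: lower_triangular_def)
    qed
  qed auto
  finally show ?case using diag by simp
qed

lemma nonneg_of_matrix_vector_zero_on_negatives:
  fixes M :: "real^'n^'n"
  assumes pd: "positive_definite M"
    and offdiag: "\<And>i j. i \<noteq> j \<Longrightarrow> M $ i $ j \<le> 0"
    and zero: "\<And>i. x $ i < 0 \<Longrightarrow> (M *v x) $ i = 0"
  shows "0 \<le> x $ i"
proof -
  define n p :: "real^'n" where "n = (\<chi> i. max (- (x $ i)) 0)" and "p = (\<chi> i. max (x $ i) 0)"
  have x: "x = p - n"
    by (simp add: vec_eq_iff n_def p_def max_def)
  have "n \<bullet> (M *v x) = 0"
    unfolding inner_vec_def using zero by (intro sum.neutral) (auto simp: n_def max_def)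
  moreover have "n \<bullet> (M *v p) \<le> 0"
  proof -
    \<comment> \<open>The sign is checked term by term in the double sum; on the diagonal one of
      \<open>n $ i\<close>, \<open>p $ i\<close> is zero.\<close>
    have "n $ i * (M $ i $ k * p $ k) \<le> 0" for i k
    proof (cases "i = k")
      case False
      then show ?thesis
        using offdiag[OF False]
        by (intro mult_nonneg_nonpos mult_nonpos_nonneg) (auto simp: n_def p_def)
    qed (auto simp: n_def p_def max_def)
    then show ?thesis
      by (auto simp: inner_vec_def matrix_vector_mult_def sum_distrib_left intro!: sum_nonpos)
  qed
  ultimately have "n \<bullet> (M *v n) \<le> 0"
    by (simp add: x matrix_vector_mult_diff_distrib inner_diff_right)
  then have "n = 0"
    using pd unfolding positive_definite_def by (meson not_le)
  then have "n $ i = 0" by simp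
  then show ?thesis by (simp add: n_def max_def split: if_splits)
qed

theorem proposition3:
  fixes \<Sigma> C :: "real^'n::{finite,wellorder}^'n::{finite,wellorder}"
  assumes "symmetric_matrix \<Sigma>" and "positive_definite \<Sigma>"
    and "is_cholesky_decomposition \<Sigma> C"
    and "\<And>i j. i \<noteq> j \<Longrightarrow> matrix_inv \<Sigma> $ i $ j \<le> 0"
  shows "\<forall>i j. C $ i $ j \<ge> 0"
proof (intro allI)
  fix i j
  let ?M = "matrix_inv \<Sigma>"
  have C: "lower_triangular C" "\<And>i. C $ i $ i > 0" "\<Sigma> = C ** transpose C"
    using assms(3) by (auto simp: is_cholesky_decomposition_def)
  have "?M ** \<Sigma> = mat 1"
    using assms(2) by (simp add: matrix_inv_left positive_definite_imp_invertible)
  then have "(?M ** C) ** transpose C = mat 1"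
    using C(3) by (metis matrix_mul_assoc)
  moreover have "C $ k $ k \<noteq> 0" for k
    using C(2)[of k] by simp
  ultimately have upper: "(?M ** C) $ k $ j = 0" if "j < k" for k
    using lower_triangular_transpose_left_inverse C(1) that by blast
  have "0 \<le> column j C $ i"
  proof (rule nonneg_of_matrix_vector_zero_on_negatives)
    show "positive_definite ?M"
      using assms(2) by (rule positive_definite_matrix_inv)
    \<comment> \<open>A negative entry of column \<open>j\<close> can only lie strictly below the
      diagonal, exactly where \<open>upper\<close> applies.\<close>
    fix k assume "column j C $ k < 0"
    then have "C $ k $ j < 0" by (simp add: column_def)
    then have "\<not> k < j" "k \<noteq> j"
      using C(1) C(2)[of j] by (auto simp: lower_triangular_def)
    then have "j < k" by simp
    then show "(?M *v column j C) $ k = 0"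
      using upper by (simp add: matrix_matrix_mult_def matrix_vector_mult_def column_def)
  qed (use assms(4) in auto)
  then show "0 \<le> C $ i $ j" by (simp add: column_def)
qed

end
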